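(* Let $F$ be a field of characteristic zero and let $g:\mathbb{Z}\to F$ be an additive and injective map. Each derivation of the Lie algebra $W(g,1)_+$ can be written as a sum of an inner derivation and a scalar derivation.
   Context: Definition of $W(g,1)_+$. It is the Lie algebra over $F$ with basis $B_+=\left\{\binom{a}{i}_1 : a\in\mathbb{Z},\ i\in\mathbb{N}\right\}$, where $\mathbb{N}$ is the set of non-negative integers (formal symbols, not binomial coefficients), and with bracket the bilinear extension of $$\left[\binom{a}{i}_1,\binom{b}{j}_1\right]=\big(g(b)-g(a)\big)\binom{a+b}{i+j}_1+(j-i)\binom{a+b}{i+j-1}_1 ,$$ where $j-i$ is regarded as an element of $F$ and the last term is read as $0$ when $i=j=0$. A derivation of a Lie algebra $L$ over $F$ is an $F$-linear map $D:L\to L$ with $D([l_1,l_2])=[D(l_1),l_2]+[l_1,D(l_2)]$ for all $l_1,l_2\in L$. An inner derivation is one of the form $\mathrm{ad}_u=[u,\cdot]$ with $u\in L$. A scalar derivation of $W(g,1)_+$ is a derivation $D$ such that for every basis element $l\in B_+$ one has $D(l)=f_l\, l$ for some scalar $f_l\in F$. *)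

theory Defs
  imports Complex_Main "HOL-Library.Poly_Mapping"
begin

locale lie_algebra = vector_space scale
  for scale :: "'a::field \<Rightarrow> 'b::ab_group_add \<Rightarrow> 'b" +
  fixes bracket :: "'b \<Rightarrow> 'b \<Rightarrow> 'b"
  assumes linear_left: "Vector_Spaces.linear scale scale (\<lambda>x. bracket x y)"
    and linear_right: "Vector_Spaces.linear scale scale (bracket x)"
    and alternating: "bracket x x = 0"
    and jacobi: "bracket x (bracket y z) + bracket y (bracket z x) + bracket z (bracket x y) = 0"

definition lie_derivation ::
    "('a::field \<Rightarrow> 'b::ab_group_add \<Rightarrow> 'b) \<Rightarrow> ('b \<Rightarrow> 'b \<Rightarrow> 'b) \<Rightarrow> ('b \<Rightarrow> 'b) \<Rightarrow> bool" where
  "lie_derivation scale bracket D \<longleftrightarrow>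
     Vector_Spaces.linear scale scale D \<and>
     (\<forall>x y. D (bracket x y) = bracket (D x) y + bracket x (D y))"

definition inner_derivation :: "('b \<Rightarrow> 'b \<Rightarrow> 'b) \<Rightarrow> ('b \<Rightarrow> 'b) \<Rightarrow> bool" where
  "inner_derivation bracket D \<longleftrightarrow> (\<exists>u. D = bracket u)"


text \<open>
  The underlying vector space of \<open>W(g,1)\<^sub>+\<close> is the space of finitely supported
  functions on \<open>int \<times> nat\<close>; the index \<open>(a, i)\<close> stands for the basis symbol with
  upper entry \<open>a\<close> and lower entry \<open>i\<close>.
\<close>

type_synonym 'a W = "(int \<times> nat) \<Rightarrow>\<^sub>0 'a"

definition W_basis :: "int \<Rightarrow> nat \<Rightarrow> 'a::field W" where
  "W_basis a i = Poly_Mapping.single (a, i) 1"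

definition W_scale :: "'a::field \<Rightarrow> 'a W \<Rightarrow> 'a W" where
  "W_scale c u = Poly_Mapping.map ((*) c) u"

text \<open>
  For \<open>i = j = 0\<close> the truncated index \<open>i + j - 1\<close> is harmless, since the coefficient
  of that term is then zero.
\<close>

definition W_basis_bracket :: "(int \<Rightarrow> 'a::field) \<Rightarrow> int \<times> nat \<Rightarrow> int \<times> nat \<Rightarrow> 'a W" where
  "W_basis_bracket g = (\<lambda>(a, i) (b, j).
     W_scale (g b - g a) (W_basis (a + b) (i + j)) +
     W_scale (of_nat j - of_nat i) (W_basis (a + b) (i + j - 1)))"

definition W_bracket :: "(int \<Rightarrow> 'a::field) \<Rightarrow> 'a W \<Rightarrow> 'a W \<Rightarrow> 'a W" where
  "W_bracket g u v = (\<Sum>p\<in>Poly_Mapping.keys u. \<Sum>q\<in>Poly_Mapping.keys v.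
     W_scale (Poly_Mapping.lookup u p * Poly_Mapping.lookup v q) (W_basis_bracket g p q))"

definition W_scalar_derivation :: "(int \<Rightarrow> 'a::field) \<Rightarrow> ('a W \<Rightarrow> 'a W) \<Rightarrow> bool" where
  "W_scalar_derivation g D \<longleftrightarrow>
     lie_derivation W_scale (W_bracket g) D \<and>
     (\<forall>a i. \<exists>f. D (W_basis a i) = W_scale f (W_basis a i))"


lemma lookup_W_scale [simp]:
  "Poly_Mapping.lookup (W_scale c u) p = c * Poly_Mapping.lookup u p"
  by (simp add: W_scale_def Poly_Mapping.map.rep_eq when_def)

interpretation W: vector_space "W_scale :: 'a::field \<Rightarrow> 'a W \<Rightarrow> 'a W"
  by unfold_locales (auto intro!: poly_mapping_eqI simp: lookup_add algebra_simps)

lemma W_expand: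
  "u = (\<Sum>p\<in>Poly_Mapping.keys u. W_scale (Poly_Mapping.lookup u p) (W_basis (fst p) (snd p)))"
proof (rule poly_mapping_eqI)
  fix k
  show "Poly_Mapping.lookup u k = Poly_Mapping.lookup
    (\<Sum>p\<in>Poly_Mapping.keys u. W_scale (Poly_Mapping.lookup u p) (W_basis (fst p) (snd p))) k"
    by (simp add: lookup_sum W_basis_def lookup_single when_def in_keys_iff if_distrib cong: if_cong)
qed

lemma W_bracket_superset:
  assumes "finite A" "finite B" "Poly_Mapping.keys u \<subseteq> A" "Poly_Mapping.keys v \<subseteq> B"
  shows "W_bracket g u v = (\<Sum>p\<in>A. \<Sum>q\<in>B.
     W_scale (Poly_Mapping.lookup u p * Poly_Mapping.lookup v q) (W_basis_bracket g p q))"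
proof -
  have "W_bracket g u v = (\<Sum>p\<in>Poly_Mapping.keys u. \<Sum>q\<in>B.
     W_scale (Poly_Mapping.lookup u p * Poly_Mapping.lookup v q) (W_basis_bracket g p q))"
    unfolding W_bracket_def
    by (intro sum.cong refl sum.mono_neutral_left) (use assms in \<open>auto simp: in_keys_iff\<close>)
  also have "\<dots> = (\<Sum>p\<in>A. \<Sum>q\<in>B.
     W_scale (Poly_Mapping.lookup u p * Poly_Mapping.lookup v q) (W_basis_bracket g p q))"
    by (intro sum.mono_neutral_left) (use assms in \<open>auto simp: in_keys_iff\<close>)
  finally show ?thesis .
qed

lemma W_bracket_add_left: "W_bracket g (u + v) w = W_bracket g u w + W_bracket g v w"
proof -
  let ?A = "Poly_Mapping.keys u \<union> Poly_Mapping.keys v"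
  show ?thesis
    using keys_add[of u v]
    by (simp add: W_bracket_superset[of ?A "Poly_Mapping.keys w"] lookup_add
        distrib_right W.scale_left_distrib sum.distrib)
qed

lemma W_bracket_add_right: "W_bracket g w (u + v) = W_bracket g w u + W_bracket g w v"
proof -
  let ?A = "Poly_Mapping.keys u \<union> Poly_Mapping.keys v"
  show ?thesis
    using keys_add[of u v]
    by (simp add: W_bracket_superset[of "Poly_Mapping.keys w" ?A] lookup_add
        distrib_left W.scale_left_distrib sum.distrib)
qed

lemma keys_W_scale: "Poly_Mapping.keys (W_scale c u) \<subseteq> Poly_Mapping.keys u"
  by (auto simp: in_keys_iff)

lemma W_bracket_scale_left: "W_bracket g (W_scale c u) w = W_scale c (W_bracket g u w)"
  using keys_W_scale[of c u]
  by (simp add: W_bracket_superset[of "Poly_Mapping.keys u" "Poly_Mapping.keys w"]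
      W.scale_sum_right mult.assoc)

lemma W_bracket_scale_right: "W_bracket g w (W_scale c u) = W_scale c (W_bracket g w u)"
  using keys_W_scale[of c u]
  by (simp add: W_bracket_superset[of "Poly_Mapping.keys w" "Poly_Mapping.keys u"]
      W.scale_sum_right mult_ac)

lemma W_linear_left: "Vector_Spaces.linear W_scale W_scale (\<lambda>x. W_bracket g x y)"
  by unfold_locales (simp_all add: W_bracket_add_left W_bracket_scale_left)

lemma W_linear_right: "Vector_Spaces.linear W_scale W_scale (W_bracket g x)"
  by unfold_locales (simp_all add: W_bracket_add_right W_bracket_scale_right)

lemma W_bracket_basis:
  "W_bracket g (W_basis a i) (W_basis b j) =
     W_scale (g b - g a) (W_basis (a + b) (i + j)) +
     W_scale (of_nat j - of_nat i) (W_basis (a + b) (i + j - 1))"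
  by (simp add: W_bracket_def W_basis_def W_basis_bracket_def)

lemma W_basis_bracket_skew: "W_basis_bracket g q p = - W_basis_bracket g p q"
  by (auto simp: W_basis_bracket_def algebra_simps split: prod.splits)

lemma W_bracket_skew: "W_bracket g v u = - W_bracket g u v"
  unfolding W_bracket_def
  by (subst sum.swap, subst W_basis_bracket_skew) (simp add: sum_negf mult.commute)

lemma W_linear_induct:
  assumes "Vector_Spaces.linear W_scale W_scale f"
    and "\<And>a i. f (W_basis a i) = 0"
  shows "f u = 0"
proof -
  interpret f: Vector_Spaces.linear W_scale W_scale f by fact
  have "f u = f (\<Sum>p\<in>Poly_Mapping.keys u.
      W_scale (Poly_Mapping.lookup u p) (W_basis (fst p) (snd p)))"
    using W_expand[of u] by simp
  then show ?thesis by (simp add: f.sum f.scale assms(2))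
qed

lemma W_bracket_alternating:
  fixes u :: "'a::field_char_0 W"
  shows "W_bracket g u u = 0"
proof (rule poly_mapping_eqI)
  fix k
  have "Poly_Mapping.lookup (W_bracket g u u) k = - Poly_Mapping.lookup (W_bracket g u u) k"
    by (metis W_bracket_skew lookup_uminus)
  then show "Poly_Mapping.lookup (W_bracket g u u) k = Poly_Mapping.lookup 0 k"
    by simp
qed

lemma W_jacobi_basis_aux:
  fixes g :: "int \<Rightarrow> 'a::field_char_0"
  assumes "additive g"
  defines "E \<equiv> \<lambda>a n. if n < 0 then 0 else W_basis a (nat n) :: 'a W"
  shows "W_bracket g (W_basis c k) (W_bracket g (W_basis a i) (W_basis b j)) =
     W_scale ((g b - g a) * (g a + g b - g c)) (E (a + b + c) (int i + int j + int k)) +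
     W_scale ((g b - g a) * (of_nat i + of_nat j - of_nat k)
              + (of_nat j - of_nat i) * (g a + g b - g c))
       (E (a + b + c) (int i + int j + int k - 1)) +
     W_scale ((of_nat j - of_nat i) * (of_nat i + of_nat j - 1 - of_nat k))
       (E (a + b + c) (int i + int j + int k - 2))"
proof -
  have nonzero: "W_bracket g (W_basis c k) (W_basis d m) =
     W_scale (g d - g c) (E (c + d) (int m + int k)) +
     W_scale (of_nat m - of_nat k) (E (c + d) (int m + int k - 1))" for d m
    by (auto simp: E_def W_bracket_basis nat_add_distrib nat_diff_distrib add_ac)
  have gab: "g (a + b) = g a + g b"
    by (rule additive.add[OF assms(1)])
  show ?thesis
  proof (cases "i + j = 0")
    case True
    then show ?thesis
      unfolding W_bracket_basis[of g a i] W_bracket_add_right W_bracket_scale_right nonzero gab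
      by (intro poly_mapping_eqI) (simp add: lookup_add algebra_simps)
  next
    case False
    then have m: "int (i + j - 1) = int i + int j - 1"
      and m': "of_nat (i + j - 1) = (of_nat i + of_nat j - 1 :: 'a)"
      by (auto simp: of_nat_diff)
    have shifts: "c + (a + b) = a + b + c" "int i + int j - 1 + int k = int i + int j + int k - 1"
      "int i + int j + int k - 1 - 1 = int i + int j + int k - 2" "int (i + j) = int i + int j"
      "of_nat (i + j) = (of_nat i + of_nat j :: 'a)"
      by simp_all
    show ?thesis
      unfolding W_bracket_basis[of g a i] W_bracket_add_right W_bracket_scale_right nonzero gab m m'
        shifts
      by (rule poly_mapping_eqI, simp only: lookup_add lookup_W_scale) algebra
  qed
qed

lemma W_jacobi_basis:
  fixes g :: "int \<Rightarrow> 'a::field_char_0"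
  assumes "additive g"
  shows "W_bracket g (W_basis a i) (W_bracket g (W_basis b j) (W_basis c k)) +
     W_bracket g (W_basis b j) (W_bracket g (W_basis c k) (W_basis a i)) +
     W_bracket g (W_basis c k) (W_bracket g (W_basis a i) (W_basis b j)) = 0"
proof -
  have shifts: "b + c + a = a + b + c" "c + a + b = a + b + c"
     "int j + int k + int i = int i + int j + int k"
     "int k + int i + int j = int i + int j + int k"
    by simp_all
  show ?thesis
    unfolding W_jacobi_basis_aux[OF assms] shifts
    by (rule poly_mapping_eqI, simp only: lookup_add lookup_W_scale lookup_zero) algebra
qed

theorem W_lie_algebra:
  fixes g :: "int \<Rightarrow> 'a::field_char_0"
  assumes "additive g"
  shows "lie_algebra W_scale (W_bracket g)"
proof (intro lie_algebra.intro lie_algebra_axioms.intro)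
  show "vector_space (W_scale :: 'a \<Rightarrow> _)" ..
next
  fix x y z :: "'a W"
  define J where "J x y z = W_bracket g x (W_bracket g y z) + W_bracket g y (W_bracket g z x)
    + W_bracket g z (W_bracket g x y)" for x y z
  note bilin = W_bracket_add_left W_bracket_add_right W_bracket_scale_left
    W_bracket_scale_right W.scale_right_distrib
  have lin: "Vector_Spaces.linear W_scale W_scale (\<lambda>x. J x y z)"
     "Vector_Spaces.linear W_scale W_scale (\<lambda>y. J x y z)"
     "Vector_Spaces.linear W_scale W_scale (\<lambda>z. J x y z)" for x y z
    by (unfold_locales; simp add: J_def bilin)+
  have "J (W_basis a i) (W_basis b j) (W_basis c k) = 0" for a b c i j k
    unfolding J_def by (rule W_jacobi_basis[OF assms])
  then have "J (W_basis a i) (W_basis b j) z = 0" for a b i j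
    by (rule W_linear_induct[OF lin(3)])
  then have "J (W_basis a i) y z = 0" for a i
    by (rule W_linear_induct[OF lin(2)])
  then have "J x y z = 0"
    by (rule W_linear_induct[OF lin(1)])
  then show "W_bracket g x (W_bracket g y z) + W_bracket g y (W_bracket g z x)
    + W_bracket g z (W_bracket g x y) = 0"
    by (simp add: J_def)
qed (rule W_linear_left W_linear_right W_bracket_alternating)+

end

theory Submission
  imports Defs
begin

text \<open>
  Read the symbol \<open>(a, i)\<close> as the formal vector field \<open>exp (g a t) t\<^sup>i d/dt\<close> on a line; the
  bracket is then the commutator, and everything is controlled by the constant field
  \<open>\<partial> = (0, 0)\<close>, which acts by \<open>[\<partial>, (b, j)] = g b (b, j) + j (b, j - 1)\<close>, that is, by
  differentiating the coefficient. Two properties of this operator carry the proof.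

  It is surjective (\<open>surj_W_bracket_partial\<close>), since every exponential polynomial has an
  antiderivative of the same kind. Hence \<open>D \<partial>\<close> is the value at \<open>\<partial>\<close> of some inner derivation, and
  after subtracting it one may assume \<open>D \<partial> = 0\<close>, so that \<open>D\<close> commutes with \<open>ad \<partial>\<close>.

  Its \<open>g a\<close>-eigenspace is the line through \<open>(a, 0)\<close> (\<open>W_bracket_partial_eigenvector\<close>), since
  injectivity of \<open>g\<close> keeps the exponents distinct. As \<open>[\<partial>, (0, 1)] = \<partial>\<close>, the element
  \<open>D (0, 1)\<close> is now a multiple of \<open>\<partial>\<close>, and subtracting the same multiple of \<open>ad \<partial>\<close> achieves
  \<open>D (0, 1) = 0\<close> without losing \<open>D \<partial> = 0\<close>.

  A derivation that kills \<open>\<partial>\<close> and \<open>(0, 1)\<close> is scalar (\<open>derivation_killing_affine_is_scalar\<close>). It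
  kills every \<open>(0, j)\<close>: inductively \<open>D (0, j)\<close> commutes with \<open>\<partial>\<close>, so it is a multiple of \<open>\<partial>\<close>, but
  the Euler field \<open>(0, 1)\<close> has weight \<open>-1\<close> on \<open>\<partial>\<close> and weight \<open>j - 1\<close> on \<open>(0, j)\<close>. It
  multiplies \<open>(a, 0)\<close> by a scalar because it preserves eigenspaces of \<open>ad \<partial>\<close>, and for \<open>a \<noteq> 0\<close>
  that scalar propagates to all \<open>(a, j)\<close> by bracketing with the elements \<open>(0, j)\<close>.
\<close>

section \<open>The action of the constant field\<close>

lemma W_induct [case_names zero add basis]:
  assumes "P 0"
    and "\<And>u v. P u \<Longrightarrow> P v \<Longrightarrow> P (u + v)"
    and "\<And>c a i. P (W_scale c (W_basis a i))"
  shows "P u"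
proof -
  have "P (\<Sum>p\<in>A. W_scale (Poly_Mapping.lookup u p) (W_basis (fst p) (snd p)))" if "finite A" for A
    using that by (induction A) (auto intro: assms)
  from this[of "Poly_Mapping.keys u"] show ?thesis
    by (simp flip: W_expand)
qed

lemma lookup_W_basis: "Poly_Mapping.lookup (W_basis a i) p = (if p = (a, i) then 1 else 0)"
  by (auto simp: W_basis_def lookup_single when_def)

lemma W_bracket_zero_right: "W_bracket g u 0 = 0"
  by (simp add: W_bracket_def)

lemma W_bracket_minus_right: "W_bracket g u (- v) = - W_bracket g u v"
  using W_bracket_scale_right[of g u "- 1" v] by simp

lemma lookup_W_bracket_partial:
  fixes g :: "int \<Rightarrow> 'a::field_char_0"
  assumes "additive g"
  shows "Poly_Mapping.lookup (W_bracket g (W_basis 0 0) v) (b, j) =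
    g b * Poly_Mapping.lookup v (b, j) + of_nat (Suc j) * Poly_Mapping.lookup v (b, Suc j)"
proof (induction v rule: W_induct)
  case zero
  show ?case by (simp add: W_bracket_zero_right)
next
  case (add u v)
  then show ?case by (simp add: W_bracket_add_right lookup_add algebra_simps)
next
  case (basis c a i)
  have "g 0 = 0"
    by (rule additive.zero[OF assms])
  then show ?case
    by (cases i) (auto simp: W_bracket_scale_right W_bracket_basis lookup_add lookup_W_basis)
qed

text \<open>
  At an exponent \<open>b \<noteq> a\<close> the eigenvector equation expresses the coefficient of \<open>t\<^sup>j\<close> through that of
  \<open>t\<^sup>j\<^sup>+\<^sup>1\<close>, so finite support forces all of them to vanish; at \<open>b = a\<close> it says that the
  derivative of a polynomial is zero.
\<close>

lemma W_bracket_partial_eigenvector: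
  fixes g :: "int \<Rightarrow> 'a::field_char_0"
  assumes "additive g" and "inj g"
    and eigen: "W_bracket g (W_basis 0 0) v = W_scale (g a) v"
  shows "v = W_scale (Poly_Mapping.lookup v (a, 0)) (W_basis a 0)"
proof -
  have recursion: "(g b - g a) * Poly_Mapping.lookup v (b, j)
      + of_nat (Suc j) * Poly_Mapping.lookup v (b, Suc j) = 0" for b j
    using lookup_W_bracket_partial[OF assms(1), of v b j] eigen
    by (simp add: algebra_simps)
  have on_exponent: "Poly_Mapping.lookup v (a, Suc j) = 0" for j
    using recursion[of a j] by (simp del: of_nat_Suc)
  have off_exponent: "Poly_Mapping.lookup v (b, j) = 0" if "b \<noteq> a" for b j
  proof -
    have "finite (snd ` Poly_Mapping.keys v)"
      by simp
    then obtain m where m: "\<And>n. n \<in> snd ` Poly_Mapping.keys v \<Longrightarrow> n < m"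
      by (meson finite_nat_set_iff_bounded)
    have "g b \<noteq> g a"
      using that injD[OF \<open>inj g\<close>, of b a] by auto
    then have step: "Poly_Mapping.lookup v (b, n) = 0" if "Poly_Mapping.lookup v (b, Suc n) = 0" for n
      using recursion[of b n] that by simp
    have top: "Poly_Mapping.lookup v (b, n) = 0" if "n \<ge> m" for n
      using m[of n] that by (force simp: in_keys_iff)
    have "Poly_Mapping.lookup v (b, m - n) = 0" for n
    proof (induction n)
      case 0
      show ?case by (simp add: top)
    next
      case (Suc n)
      then show ?case
        using step[of "m - Suc n"] by (cases "n < m") (auto simp: Suc_diff_Suc)
    qed
    from this[of "m - j"] show ?thesis
      using top by (cases "j \<le> m") auto
  qed
  show ?thesis
  proof (rule poly_mapping_eqI)
    fix p
    show "Poly_Mapping.lookup v p =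
        Poly_Mapping.lookup (W_scale (Poly_Mapping.lookup v (a, 0)) (W_basis a 0)) p"
    proof (cases p)
      case (Pair b j)
      then show ?thesis
        by (cases "b = a"; cases j) (auto simp: lookup_W_basis on_exponent off_exponent)
    qed
  qed
qed

text \<open>
  Antiderivatives: \<open>t\<^sup>j\<^sup>+\<^sup>1 / (j + 1)\<close> for exponent zero, and repeated integration by parts
  otherwise.
\<close>

lemma surj_W_bracket_partial:
  fixes g :: "int \<Rightarrow> 'a::field_char_0"
  assumes "additive g" and "inj g"
  shows "surj (W_bracket g (W_basis 0 0))"
proof -
  let ?ad = "W_bracket g (W_basis 0 0)"
  have g0: "g 0 = 0"
    by (rule additive.zero[OF assms(1)])
  have antiderivative: "\<exists>w. ?ad w = W_basis b j" for b j
  proof (cases "b = 0")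
    case True
    have "?ad (W_scale (inverse (of_nat (Suc j))) (W_basis 0 (Suc j))) = W_basis 0 j"
      by (simp add: W_bracket_scale_right W_bracket_basis g0 del: of_nat_Suc)
    then show ?thesis using True by blast
  next
    case False
    then have gb: "g b \<noteq> 0"
      using injD[OF \<open>inj g\<close>, of b 0] g0 by auto
    show ?thesis
    proof (induction j)
      case 0
      have "?ad (W_scale (inverse (g b)) (W_basis b 0)) = W_basis b 0"
        using gb by (simp add: W_bracket_scale_right W_bracket_basis g0)
      then show ?case by blast
    next
      case (Suc j)
      then obtain w where w: "?ad w = W_basis b j" by blast
      have "?ad (W_scale (inverse (g b)) (W_basis b (Suc j) + - W_scale (of_nat (Suc j)) w))
          = W_basis b (Suc j)"
        using gb by (simp add: W_bracket_scale_right W_bracket_add_right W_bracket_minus_right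
            W_bracket_basis g0 w del: of_nat_Suc add_uminus_conv_diff)
      then show ?case by blast
    qed
  qed
  have "\<exists>w. ?ad w = v" for v
  proof (induction v rule: W_induct)
    case zero
    show ?case using W_bracket_zero_right by blast
  next
    case (add u v)
    then show ?case by (metis W_bracket_add_right)
  next
    case (basis c a i)
    show ?case by (metis antiderivative W_bracket_scale_right)
  qed
  then show ?thesis unfolding surj_def by metis
qed

section \<open>Derivations\<close>

lemma W_linear_iff:
  "Vector_Spaces.linear W_scale W_scale D \<longleftrightarrow>
     (\<forall>u v. D (u + v) = D u + D v) \<and> (\<forall>c u. D (W_scale c u) = W_scale c (D u))"
  by (simp add: Vector_Spaces.linear_def module_hom_def module_hom_axioms_def
      W.vector_space_axioms W.module_axioms)

lemma W_derivationD:
  assumes "lie_derivation W_scale (W_bracket g) D"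
  shows "D (u + v) = D u + D v" and "D (W_scale c u) = W_scale c (D u)"
    and "D (W_bracket g u v) = W_bracket g (D u) v + W_bracket g u (D v)"
  using assms by (auto simp: lie_derivation_def W_linear_iff)

lemma W_bracket_leibniz:
  fixes g :: "int \<Rightarrow> 'a::field_char_0"
  assumes "additive g"
  shows "W_bracket g w (W_bracket g u v) =
    W_bracket g (W_bracket g w u) v + W_bracket g u (W_bracket g w v)"
proof -
  interpret lie_algebra W_scale "W_bracket g"
    by (rule W_lie_algebra[OF assms])
  have "W_bracket g u (W_bracket g v w) = - W_bracket g u (W_bracket g w v)"
    by (metis W_bracket_skew W_bracket_minus_right)
  moreover have "W_bracket g v (W_bracket g w u) = - W_bracket g (W_bracket g w u) v"
    by (rule W_bracket_skew)
  ultimately show ?thesis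
    using jacobi[of w u v] by (simp add: algebra_simps)
qed

lemma derivation_minus_ad:
  fixes g :: "int \<Rightarrow> 'a::field_char_0"
  assumes "additive g" and D: "lie_derivation W_scale (W_bracket g) D"
  shows "lie_derivation W_scale (W_bracket g) (\<lambda>x. D x - W_bracket g w x)"
proof -
  have split: "D u - W_bracket g w u = D u + W_scale (- 1) (W_bracket g w u)" for u
    by simp
  show ?thesis
    unfolding lie_derivation_def W_linear_iff split
    by (simp add: W_derivationD[OF D] W_bracket_add_right W_bracket_scale_right
        W_bracket_add_left W_bracket_scale_left W_bracket_leibniz[OF assms(1), of w]
        W.scale_right_distrib mult.commute
        del: W.scale_minus_left W.scale_one)
qed

text \<open>
  The elements \<open>(0, 0)\<close> and \<open>(0, 1)\<close> span the Lie algebra of affine fields on the line. Since a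
  derivation killing them commutes with their adjoint actions, it preserves the eigenspaces of
  both, which pins down its values on \<open>(0, j)\<close> and \<open>(a, 0)\<close>; these elements generate the rest.
\<close>

lemma derivation_killing_affine_is_scalar:
  fixes g :: "int \<Rightarrow> 'a::field_char_0"
  assumes "additive g" and "inj g" and D: "lie_derivation W_scale (W_bracket g) D"
    and partial: "D (W_basis 0 0) = 0" and euler: "D (W_basis 0 1) = 0"
  shows "W_scalar_derivation g D"
proof -
  note D_simps = W_derivationD[OF D]
  have g0: "g 0 = 0"
    by (rule additive.zero[OF assms(1)])
  have bracket_zero_left: "W_bracket g 0 v = 0" for v
    by (simp add: W_bracket_def)
  have ad_partial: "W_bracket g (W_basis 0 0) (D v) = D (W_bracket g (W_basis 0 0) v)" for v
    by (simp add: D_simps partial bracket_zero_left)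
  have exponent_zero: "D (W_basis 0 j) = 0" for j
  proof (induction j)
    case 0
    show ?case by (rule partial)
  next
    case (Suc j)
    let ?v = "D (W_basis 0 (Suc j))"
    define c where "c = Poly_Mapping.lookup ?v (0, 0)"
    have "W_bracket g (W_basis 0 0) ?v = W_scale (g 0) ?v"
      by (simp add: ad_partial W_bracket_basis g0 D_simps Suc)
    then have v: "?v = W_scale c (W_basis 0 0)"
      unfolding c_def by (rule W_bracket_partial_eigenvector[OF assms(1,2)])
    have "W_scale (of_nat j) ?v = D (W_bracket g (W_basis 0 1) (W_basis 0 (Suc j)))"
      by (simp add: W_bracket_basis g0 D_simps)
    also have "\<dots> = W_bracket g (W_basis 0 1) ?v"
      by (simp add: D_simps euler[simplified] bracket_zero_left)
    also have "\<dots> = W_scale (- c) (W_basis 0 0)"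
      by (simp add: v W_bracket_scale_right W_bracket_basis g0)
    finally have "Poly_Mapping.lookup (W_scale (of_nat j) ?v) (0, 0)
        = Poly_Mapping.lookup (W_scale (- c) (W_basis 0 0)) (0, 0)"
      by simp
    then have "of_nat (Suc j) * c = 0"
      by (simp add: lookup_W_basis v algebra_simps)
    then have "c = 0"
      by (simp del: of_nat_Suc)
    then show ?case by (simp add: v)
  qed
  have "\<exists>f. D (W_basis a i) = W_scale f (W_basis a i)" for a i
  proof (cases "a = 0")
    case True
    then have "D (W_basis a i) = W_scale 0 (W_basis a i)"
      by (simp add: exponent_zero)
    then show ?thesis ..
  next
    case False
    then have ga: "g a \<noteq> 0"
      using injD[OF \<open>inj g\<close>, of a 0] g0 by auto
    define f where "f = Poly_Mapping.lookup (D (W_basis a 0)) (a, 0)"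
    have "W_bracket g (W_basis 0 0) (D (W_basis a 0)) = W_scale (g a) (D (W_basis a 0))"
      by (simp add: ad_partial W_bracket_basis g0 D_simps)
    then have base: "D (W_basis a 0) = W_scale f (W_basis a 0)"
      unfolding f_def by (rule W_bracket_partial_eigenvector[OF assms(1,2)])
    have "D (W_basis a i) = W_scale f (W_basis a i)"
    proof (induction i)
      case 0
      show ?case by (rule base)
    next
      case (Suc i)
      \<comment> \<open>As \<open>g a\<close> is invertible, the bracket formula for \<open>(0, i + 1)\<close> and \<open>(a, 0)\<close> can be
        solved for \<open>(a, i + 1)\<close>.\<close>
      let ?B = "W_bracket g (W_basis 0 (Suc i)) (W_basis a 0)"
      have generate: "W_basis a (Suc i) =
          W_scale (inverse (g a)) (?B + W_scale (of_nat (Suc i)) (W_basis a i))"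
        using ga by (simp add: W_bracket_basis g0 del: of_nat_Suc)
      have "D ?B = W_scale f ?B"
        by (simp add: D_simps exponent_zero bracket_zero_left base W_bracket_scale_right)
      then show ?case
        by (subst (1 2) generate) (simp add: D_simps Suc W.scale_right_distrib mult_ac del: of_nat_Suc)
    qed
    then show ?thesis ..
  qed
  then show ?thesis
    using D by (simp add: W_scalar_derivation_def)
qed

section \<open>The decomposition\<close>

theorem theorem3:
  fixes g :: "int \<Rightarrow> 'a::field_char_0" and D :: "'a W \<Rightarrow> 'a W"
  assumes "additive g" and "inj g"
    and "lie_derivation W_scale (W_bracket g) D"
  shows "\<exists>I S. inner_derivation (W_bracket g) I \<and> W_scalar_derivation g S \<and>
           D = (\<lambda>x. I x + S x)"
proof -
  let ?p = "W_basis 0 0 :: 'a W"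
  have g0: "g 0 = 0"
    by (rule additive.zero[OF assms(1)])
  obtain u where "D ?p = W_bracket g ?p u"
    using surj_W_bracket_partial[OF assms(1,2)] by (metis surjD)
  then have u: "D ?p = W_bracket g (W_scale (- 1) u) ?p"
    using W_bracket_skew[of g ?p u] by (simp only: W_bracket_scale_left) simp
  define E where "E x = D x - W_bracket g (W_scale (- 1) u) x" for x
  have E: "lie_derivation W_scale (W_bracket g) E"
    unfolding E_def by (rule derivation_minus_ad[OF assms(1,3)])
  have E_p: "E ?p = 0"
    by (simp add: E_def u)
  define c where "c = Poly_Mapping.lookup (E (W_basis 0 1)) (0, 0)"
  have bracket_p_euler: "W_bracket g ?p (W_basis 0 1) = ?p"
    by (simp add: W_bracket_basis g0)
  have "W_bracket g ?p (E (W_basis 0 1)) = W_scale (g 0) (E (W_basis 0 1))"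
    using W_derivationD(3)[OF E, of ?p "W_basis 0 1"]
    by (simp only: bracket_p_euler E_p) (simp add: g0 W_bracket_def)
  then have E_euler: "E (W_basis 0 1) = W_scale c ?p"
    unfolding c_def by (rule W_bracket_partial_eigenvector[OF assms(1,2)])
  define S where "S x = E x - W_bracket g (W_scale c ?p) x" for x
  have S: "lie_derivation W_scale (W_bracket g) S"
    unfolding S_def by (rule derivation_minus_ad[OF assms(1) E])
  have "S ?p = 0"
    by (simp add: S_def E_p W_bracket_scale_left W_bracket_alternating)
  moreover have "S (W_basis 0 1) = 0"
    by (simp only: S_def E_euler W_bracket_scale_left bracket_p_euler) simp
  ultimately have "W_scalar_derivation g S"
    by (rule derivation_killing_affine_is_scalar[OF assms(1,2) S])
  moreover have "D = (\<lambda>x. W_bracket g (W_scale (- 1) u + W_scale c ?p) x + S x)"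
    by (rule ext) (simp only: S_def E_def W_bracket_add_left, simp)
  ultimately show ?thesis
    unfolding inner_derivation_def by blast
qed

end
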